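(* Let $R$ be an EPRF-TRS over a ranked alphabet $\Sigma$ and let $p,q\in T_\Sigma(X)$. Then it is decidable whether $p\Rightarrow^*_R q$.
   Context: A ranked alphabet $\Sigma$ is a finite set of symbols with ranks; $X=\{x_1,x_2,\dots\}$ is a countable set of variables, $T_\Sigma(X)$ the terms over $\Sigma$ and $X$, $T_\Sigma$ the ground terms. A TRS $R$ over $\Sigma$ is a finite set of rules $l\to r$, $l,r\in T_\Sigma(X)$, with every variable of $r$ occurring in $l$; $\Rightarrow_R$ is the rewrite relation, $\Rightarrow^*_R$ its reflexive transitive closure; $sign(R)$ is the set of symbols occurring in the rules. For $L\subseteq T_\Sigma$, $R^*_\Sigma(L)=\{p\mid q\Rightarrow^*_R p,\ q\in L\}$. A bottom-up tree automaton (bta) over $\Sigma$ is a finite automaton with states $A$ (treated as constants), final states $A_f$, rules $\delta(a_1,\dots,a_n)\to a$ and $a\to a'$; it recognizes the ground terms rewriting to a final state. $R$ is an EPRF-TRS if for any given ranked alphabet $\Sigma\supseteq sign(R)$ and finite $L\subseteq T_\Sigma$ one can effectively construct a bta $\mathcal{C}$ over $\Sigma$ with $L(\mathcal{C})=R^*_\Sigma(L)$. *)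

theory Defs
  imports Main "HOL-Library.Nat_Bijection"
begin

section \<open>Terms, ranked alphabets and term rewriting\<close>

text \<open>
  Function symbols and variables are named by natural numbers, so that there is an infinite supply
  of symbols from which ranked alphabets are chosen, and all syntactic objects are finite data.
  A ranked alphabet is a finite set of pairs (symbol, rank) giving every symbol one rank.
\<close>

datatype trm = Var nat | Fun nat "trm list"

type_synonym alphabet = "(nat \<times> nat) set"
type_synonym rule = "trm \<times> trm"

definition ranked_alphabet :: "alphabet \<Rightarrow> bool" where
  "ranked_alphabet \<Sigma> \<longleftrightarrow> finite \<Sigma> \<and> single_valued \<Sigma>"

fun trm_vars :: "trm \<Rightarrow> nat set" where
  "trm_vars (Var x) = {x}"
| "trm_vars (Fun f ts) = (\<Union>t \<in> set ts. trm_vars t)"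

fun trm_sign :: "trm \<Rightarrow> alphabet" where
  "trm_sign (Var x) = {}"
| "trm_sign (Fun f ts) = insert (f, length ts) (\<Union>t \<in> set ts. trm_sign t)"

definition terms :: "alphabet \<Rightarrow> trm set" where
  "terms \<Sigma> = {t. trm_sign t \<subseteq> \<Sigma>}"

definition ground_terms :: "alphabet \<Rightarrow> trm set" where
  "ground_terms \<Sigma> = {t \<in> terms \<Sigma>. trm_vars t = {}}"

text \<open>As in the source, the left-hand side of a rule may be a variable.\<close>

definition trs :: "alphabet \<Rightarrow> rule set \<Rightarrow> bool" where
  "trs \<Sigma> R \<longleftrightarrow> finite R \<and>
     (\<forall>(l, r) \<in> R. l \<in> terms \<Sigma> \<and> r \<in> terms \<Sigma> \<and> trm_vars r \<subseteq> trm_vars l)"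

definition sign :: "rule set \<Rightarrow> alphabet" where
  "sign R = (\<Union>(l, r) \<in> R. trm_sign l \<union> trm_sign r)"

fun subst :: "(nat \<Rightarrow> trm) \<Rightarrow> trm \<Rightarrow> trm" where
  "subst \<sigma> (Var x) = \<sigma> x"
| "subst \<sigma> (Fun f ts) = Fun f (map (subst \<sigma>) ts)"

inductive_set rstep :: "rule set \<Rightarrow> (trm \<times> trm) set" for R where
  root: "(l, r) \<in> R \<Longrightarrow> (subst \<sigma> l, subst \<sigma> r) \<in> rstep R"
| ctxt: "(s, t) \<in> rstep R \<Longrightarrow> (Fun f (us @ s # vs), Fun f (us @ t # vs)) \<in> rstep R"

text \<open>
  A rewrite sequence that starts with a term over the alphabet of the system never leaves that
  alphabet and introduces no variables, so the descendants need no explicit restriction.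
\<close>

definition descendants :: "rule set \<Rightarrow> trm set \<Rightarrow> trm set" where
  "descendants R L = {p. \<exists>q \<in> L. (q, p) \<in> (rstep R)\<^sup>*}"


section \<open>Bottom-up tree automata\<close>

text \<open>States are constants whose names are not used by the alphabet.\<close>

record bta =
  states :: "nat set"
  finals :: "nat set"
  rules :: "rule set"

definition state_trm :: "nat \<Rightarrow> trm" where
  "state_trm a = Fun a []"

definition is_bta :: "alphabet \<Rightarrow> bta \<Rightarrow> bool" where
  "is_bta \<Sigma> C \<longleftrightarrow>
     finite (states C) \<and> states C \<inter> fst ` \<Sigma> = {} \<and> finals C \<subseteq> states C \<and> finite (rules C) \<and>
     (\<forall>\<rho> \<in> rules C.
        (\<exists>f as a. \<rho> = (Fun f (map state_trm as), state_trm a) \<and>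
           (f, length as) \<in> \<Sigma> \<and> set as \<subseteq> states C \<and> a \<in> states C) \<or>
        (\<exists>a a'. \<rho> = (state_trm a, state_trm a') \<and> a \<in> states C \<and> a' \<in> states C))"

definition bta_lang :: "alphabet \<Rightarrow> bta \<Rightarrow> trm set" where
  "bta_lang \<Sigma> C =
     {t \<in> ground_terms \<Sigma>. \<exists>a \<in> finals C. (t, state_trm a) \<in> (rstep (rules C))\<^sup>*}"


section \<open>Partial recursive functions\<close>

text \<open>
  Algorithms are descriptions of partial recursive functions. The relation below says that the
  function described by its first argument is defined at the given arguments and has the given
  value there. The recursion argument of \<^term>\<open>Prec\<close> and the search variable
  of \<^term>\<open>Mini\<close> come first in the argument list.
\<close>

datatype recf =
    Zero
  | Succ
  | Proj nat
  | Comp recf "recf list"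
  | Prec recf recf
  | Mini recf

inductive evaluates :: "recf \<Rightarrow> nat list \<Rightarrow> nat \<Rightarrow> bool" where
  Zero: "evaluates Zero xs 0"
| Succ: "evaluates Succ [x] (Suc x)"
| Proj: "i < length xs \<Longrightarrow> evaluates (Proj i) xs (xs ! i)"
| Comp: "list_all2 (\<lambda>g y. evaluates g xs y) gs ys \<Longrightarrow> evaluates f ys z \<Longrightarrow>
    evaluates (Comp f gs) xs z"
| Prec_0: "evaluates f xs y \<Longrightarrow> evaluates (Prec f g) (0 # xs) y"
| Prec_Suc: "evaluates (Prec f g) (n # xs) y \<Longrightarrow> evaluates g (y # n # xs) z \<Longrightarrow>
    evaluates (Prec f g) (Suc n # xs) z"
| Mini: "evaluates f (n # xs) 0 \<Longrightarrow> (\<And>i. i < n \<Longrightarrow> \<exists>y. evaluates f (i # xs) (Suc y)) \<Longrightarrow>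
    evaluates (Mini f) xs n"

inductive_cases evaluates_ZeroE: "evaluates Zero xs y"
inductive_cases evaluates_SuccE: "evaluates Succ xs y"
inductive_cases evaluates_ProjE: "evaluates (Proj i) xs y"
inductive_cases evaluates_CompE: "evaluates (Comp f gs) xs y"
inductive_cases evaluates_Prec_0E: "evaluates (Prec f g) (0 # xs) y"
inductive_cases evaluates_Prec_SucE: "evaluates (Prec f g) (Suc n # xs) y"
inductive_cases evaluates_MiniE: "evaluates (Mini f) xs y"

lemma evaluates_deterministic:
  assumes "evaluates f xs y" and "evaluates f xs z"
  shows "y = z"
  using assms
proof (induction arbitrary: z rule: evaluates.induct)
  case (Comp xs gs ys f w)
  from Comp.prems obtain ys' where ys': "list_all2 (\<lambda>g y. evaluates g xs y) gs ys'"
    and z: "evaluates f ys' z"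
    by (rule evaluates_CompE)
  have "ys = ys'"
  proof (rule nth_equalityI)
    show "length ys = length ys'"
      using Comp.IH(1) ys' by (simp add: list_all2_conv_all_nth)
    show "ys ! i = ys' ! i" if "i < length ys" for i
      using Comp.IH(1) ys' that by (auto simp: list_all2_conv_all_nth)
  qed
  with z Comp.IH show ?case by blast
next
  case (Prec_Suc f g n xs y w)
  from Prec_Suc.prems obtain y' where "evaluates (Prec f g) (n # xs) y'"
    and "evaluates g (y' # n # xs) z"
    by (rule evaluates_Prec_SucE)
  with Prec_Suc.IH show ?case by blast
next
  case (Mini f n xs)
  from Mini.prems have z: "evaluates f (z # xs) 0"
    and below: "\<And>i. i < z \<Longrightarrow> \<exists>y. evaluates f (i # xs) (Suc y)"
    by (auto elim: evaluates_MiniE)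
  have "\<not> n < z"
  proof
    assume "n < z"
    then obtain y where "evaluates f (n # xs) (Suc y)"
      using below by blast
    with Mini.IH(1) show False by (metis nat.distinct(1))
  qed
  moreover have "\<not> z < n"
  proof
    assume "z < n"
    with Mini.IH(2) obtain y where "\<And>w. evaluates f (z # xs) w \<Longrightarrow> Suc y = w" by blast
    with z show False by (metis nat.distinct(1))
  qed
  ultimately show ?case by simp
next
  case (Zero xs)
  then show ?case by (rule evaluates_ZeroE) simp
next
  case (Succ x)
  then show ?case by (rule evaluates_SuccE) simp
next
  case (Proj i xs)
  from Proj.prems show ?case by (rule evaluates_ProjE) simp
next
  case (Prec_0 f xs y g)
  from Prec_0.prems have "evaluates f xs z" by (rule evaluates_Prec_0E)
  then show ?case by (rule Prec_0.IH)
qed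


section \<open>Goedel numbers\<close>

text \<open>
  Pairs, lists and finite sets of numbers are coded by the bijections of the library; in particular
  \<^term>\<open>set_encode A\<close> is the sum of the powers of two with exponents in \<^term>\<open>A\<close>.
\<close>

fun trm_encode :: "trm \<Rightarrow> nat" where
  "trm_encode (Var x) = prod_encode (0, x)"
| "trm_encode (Fun f ts) = prod_encode (Suc f, list_encode (map trm_encode ts))"

definition trms_encode :: "trm set \<Rightarrow> nat" where
  "trms_encode L = set_encode (trm_encode ` L)"

definition alphabet_encode :: "alphabet \<Rightarrow> nat" where
  "alphabet_encode \<Sigma> = set_encode (prod_encode ` \<Sigma>)"

definition rules_encode :: "rule set \<Rightarrow> nat" where
  "rules_encode R = set_encode ((\<lambda>(l, r). prod_encode (trm_encode l, trm_encode r)) ` R)"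

definition bta_encode :: "bta \<Rightarrow> nat" where
  "bta_encode C =
     prod_encode (set_encode (states C),
       prod_encode (set_encode (finals C), rules_encode (rules C)))"

lemma trm_encode_eq_iff: "trm_encode s = trm_encode t \<longleftrightarrow> s = t"
proof
  show "trm_encode s = trm_encode t \<Longrightarrow> s = t"
  proof (induction s arbitrary: t)
    case (Var x)
    then show ?case by (cases t) auto
  next
    case (Fun f ss)
    then obtain ts where t: "t = Fun f ts" and eq: "map trm_encode ss = map trm_encode ts"
      by (cases t) (auto simp: list_encode_eq)
    have "ss = ts"
    proof (rule nth_equalityI)
      show len: "length ss = length ts"
        using eq by (rule map_eq_imp_length_eq)
      show "ss ! i = ts ! i" if "i < length ss" for i
        using Fun.IH[of "ss ! i" "ts ! i"] that len arg_cong[OF eq, of "\<lambda>xs. xs ! i"] by simp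
    qed
    with t show ?case by simp
  qed
qed simp

lemma bta_encode_eq_iff:
  assumes "is_bta \<Sigma> C" and "is_bta \<Sigma>' D"
  shows "bta_encode C = bta_encode D \<longleftrightarrow> C = D"
proof
  let ?code = "\<lambda>(l, r). prod_encode (trm_encode l, trm_encode r)"
  assume "bta_encode C = bta_encode D"
  moreover have "finite (states C)" "finite (states D)" "finite (finals C)" "finite (finals D)"
    "finite (?code ` rules C)" "finite (?code ` rules D)"
    using assms unfolding is_bta_def by (auto intro: finite_subset)
  ultimately have "states C = states D" "finals C = finals D" "?code ` rules C = ?code ` rules D"
    unfolding bta_encode_def rules_encode_def by (simp_all add: set_encode_eq)
  moreover have "inj ?code"
    by (auto intro!: injI simp: trm_encode_eq_iff)
  ultimately show "C = D"
    by (simp add: inj_image_eq_iff)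
qed simp


section \<open>Effective constructions and decidability\<close>

text \<open>
  One algorithm must construct the automaton from the alphabet and the finite language. It has to
  halt on codes of admissible inputs only.
\<close>

definition eprf :: "rule set \<Rightarrow> bool" where
  "eprf R \<longleftrightarrow>
     (\<exists>M. \<forall>\<Sigma> L. ranked_alphabet \<Sigma> \<and> sign R \<subseteq> \<Sigma> \<and> finite L \<and> L \<subseteq> ground_terms \<Sigma> \<longrightarrow>
        (\<exists>C. is_bta \<Sigma> C \<and> bta_lang \<Sigma> C = descendants R L \<and>
             evaluates M [alphabet_encode \<Sigma>, trms_encode L] (bta_encode C)))"

text \<open>
  A problem is given by its set of instances, their codes and the property in question. One
  algorithm must halt on every instance with the correct answer.
\<close>

definition decidable :: "'a set \<Rightarrow> ('a \<Rightarrow> nat list) \<Rightarrow> ('a \<Rightarrow> bool) \<Rightarrow> bool" where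
  "decidable I enc P \<longleftrightarrow> (\<exists>M. \<forall>x \<in> I. evaluates M (enc x) (if P x then 1 else 0))"

end

(*
  Replace the variables of p and q by fresh constants and add these constants to the alphabet; a
  rewrite sequence between the resulting ground terms can be translated back, because the rules do
  not mention the new constants. The EPRF algorithm yields an automaton for the descendants of the
  frozen p, and it remains to test whether that automaton accepts the frozen q. The pairs (t, u) such
  that the automaton rewrites t to u, with t bounded by the code of q and u by the codes of the rules,
  form the least fixed point of a monotone operator on a finite set, reached by iteration.
*)
theory Submission
  imports Defs
begin

section \<open>Total computable functions\<close>

text \<open>Decidability asks for a \<open>recf\<close>, so every ingredient of the procedure must
  be computable on codes. \<open>\<Sigma>\<close> and \<open>R\<close> are fixed, hence a bound
  \<open>c\<close> above all symbol names and the code of \<open>\<Sigma>\<close> are constants of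
  the algorithm. How many fresh constants are needed depends on the instance; a term code bounds the
  variables of the term, so the two codes supply a sufficient number. The automaton is known only at
  run time and its states have arbitrary names, so membership must be decided uniformly in its code.
  General rewriting produces intermediate terms that mix states and symbols; runs avoid them, since
  the premises of a run start from the same term or from its arguments. The construction algorithm
  is guaranteed to halt on admissible inputs only, so it does not fit a calculus of total functions:
  it enters through an explicit \<open>Comp\<close>, and everything around it is total.\<close>

lemma evaluates_Proj_0: "evaluates (Proj 0) (x # xs) x"
  using evaluates.Proj[of 0 "x # xs"] by simp

lemma evaluates_Proj_1: "evaluates (Proj 1) (x # y # xs) y"
  using evaluates.Proj[of 1 "x # y # xs"] by simp

lemma evaluates_Proj_2: "evaluates (Proj 2) (x # y # z # xs) z"
  using evaluates.Proj[of 2 "x # y # z # xs"] by simp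

lemma evaluates_Comp_1:
  "evaluates g xs y \<Longrightarrow> evaluates f [y] z \<Longrightarrow> evaluates (Comp f [g]) xs z"
  by (rule evaluates.Comp[of _ _ "[y]"]) auto

lemma evaluates_Comp_2:
  "evaluates g xs y \<Longrightarrow> evaluates h xs y' \<Longrightarrow> evaluates f [y, y'] z \<Longrightarrow>
    evaluates (Comp f [g, h]) xs z"
  by (rule evaluates.Comp[of _ _ "[y, y']"]) auto

lemmas evaluates_basic = evaluates.Zero evaluates.Succ evaluates_Proj_0 evaluates_Proj_1
  evaluates_Proj_2 evaluates_Comp_1 evaluates_Comp_2

definition recf_add :: recf where
  "recf_add = Prec (Proj 0) (Comp Succ [Proj 0])"

lemma evaluates_add: "evaluates recf_add [m, n] (m + n)"
proof (induction m)
  case 0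
  then show ?case by (auto simp: recf_add_def intro: evaluates.Prec_0 evaluates_basic)
next
  case (Suc m)
  then show ?case
    unfolding recf_add_def by (auto intro!: evaluates.Prec_Suc evaluates_basic)
qed

text \<open>The recursion step ignores the previous value and returns the counter, which is the
  predecessor of the argument.\<close>

definition recf_pred :: recf where
  "recf_pred = Comp (Prec Zero (Proj 1)) [Proj 0, Zero]"

lemma evaluates_pred: "evaluates recf_pred [n] (n - 1)"
proof -
  have "evaluates (Prec Zero (Proj 1)) [n, 0] (n - 1)"
  proof (induction n)
    case 0
    then show ?case by (auto intro: evaluates.Prec_0 evaluates_basic)
  next
    case (Suc n)
    show ?case
      using evaluates.Prec_Suc[OF Suc evaluates_Proj_1] by simp
  qed
  then show ?thesis
    unfolding recf_pred_def by (blast intro: evaluates_basic)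
qed

text \<open>\<open>Prec\<close> recurses on its first argument, truncated subtraction on the
  subtrahend; hence the exchange of the two arguments.\<close>

definition recf_monus :: recf where
  "recf_monus = Comp (Prec (Proj 0) (Comp recf_pred [Proj 0])) [Proj 1, Proj 0]"

lemma evaluates_monus: "evaluates recf_monus [m, n] (m - n)"
proof -
  have "evaluates (Prec (Proj 0) (Comp recf_pred [Proj 0])) [n, m] (m - n)"
  proof (induction n)
    case 0
    then show ?case by (auto intro: evaluates.Prec_0 evaluates_basic)
  next
    case (Suc n)
    have "evaluates recf_pred [m - n] (m - Suc n)"
      using evaluates_pred[of "m - n"] by simp
    with Suc show ?case
      by (blast intro: evaluates.Prec_Suc evaluates_basic)
  qed
  then show ?thesis
    unfolding recf_monus_def by (blast intro: evaluates_basic)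
qed

section \<open>Cantor pairing and its inverse\<close>

definition recf_triangle :: recf where
  "recf_triangle = Comp (Prec Zero (Comp recf_add [Proj 0, Comp Succ [Proj 1]])) [Proj 0, Zero]"

lemma evaluates_triangle: "evaluates recf_triangle [n] (triangle n)"
proof -
  have "evaluates (Prec Zero (Comp recf_add [Proj 0, Comp Succ [Proj 1]])) [n, 0] (triangle n)"
  proof (induction n)
    case 0
    then show ?case by (auto intro: evaluates.Prec_0 evaluates_basic)
  next
    case (Suc n)
    have "evaluates recf_add [triangle n, Suc n] (triangle (Suc n))"
      using evaluates_add[of "triangle n" "Suc n"] by simp
    with Suc show ?case
      by (blast intro: evaluates.Prec_Suc evaluates_basic)
  qed
  then show ?thesis
    unfolding recf_triangle_def by (blast intro: evaluates_basic)
qed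

definition recf_pair :: recf where
  "recf_pair = Comp recf_add [Comp recf_triangle [recf_add], Proj 0]"

lemma evaluates_pair: "evaluates recf_pair [m, n] (prod_encode (m, n))"
  unfolding recf_pair_def prod_encode_def prod.case
  by (blast intro: evaluates_basic evaluates_add evaluates_triangle)

definition pfst :: "nat \<Rightarrow> nat" where
  "pfst z = fst (prod_decode z)"

definition psnd :: "nat \<Rightarrow> nat" where
  "psnd z = snd (prod_decode z)"

lemma pfst_prod_encode [simp]: "pfst (prod_encode (x, y)) = x"
  by (simp add: pfst_def)

lemma psnd_prod_encode [simp]: "psnd (prod_encode (x, y)) = y"
  by (simp add: psnd_def)

lemma prod_encode_pfst_psnd [simp]: "prod_encode (pfst z, psnd z) = z"
  by (simp add: pfst_def psnd_def)

lemma pfst_le: "pfst z \<le> z"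
  using le_prod_encode_1[of "pfst z" "psnd z"] by simp

lemma psnd_le: "psnd z \<le> z"
  using le_prod_encode_2[of "psnd z" "pfst z"] by simp

lemma triangle_mono: "m \<le> n \<Longrightarrow> triangle m \<le> triangle n"
  by (induction rule: dec_induct) auto

text \<open>The index of the diagonal that contains \<open>z\<close> grows by one exactly when the next
  triangular number is reached; truncated subtraction expresses the test.\<close>

fun triangle_root :: "nat \<Rightarrow> nat" where
  "triangle_root 0 = 0"
| "triangle_root (Suc z) =
     triangle_root z + (1 - (triangle (Suc (triangle_root z)) - Suc z))"

lemma triangle_root_bounds:
  "triangle (triangle_root z) \<le> z \<and> z < triangle (Suc (triangle_root z))"
proof (induction z)
  case (Suc z)
  show ?case
  proof (cases "Suc z = triangle (Suc (triangle_root z))")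
    case True
    then have "triangle_root (Suc z) = Suc (triangle_root z)" by simp
    then show ?thesis using True by (simp only: triangle_Suc[of "Suc _"]) simp
  next
    case False
    then have "triangle_root (Suc z) = triangle_root z" using Suc by simp
    then show ?thesis using False Suc by simp
  qed
qed simp

text \<open>By monotonicity of \<open>triangle\<close>, at most one \<open>k\<close> satisfies
  \<open>triangle k \<le> z < triangle (Suc k)\<close>, and both sides do: the pairing function
  places \<open>z\<close> on the diagonal numbered by the sum of its components.\<close>

lemma triangle_root_eq: "triangle_root z = pfst z + psnd z"
proof -
  let ?s = "pfst z + psnd z" and ?r = "triangle_root z"
  have z: "z = triangle ?s + pfst z"
    using prod_encode_pfst_psnd[of z] by (simp add: prod_encode_def)
  then have "triangle ?s \<le> z" "z < triangle (Suc ?s)" by simp_all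
  moreover have "triangle ?r \<le> z" "z < triangle (Suc ?r)"
    using triangle_root_bounds by blast+
  moreover have "\<not> ?s < ?r" "\<not> ?r < ?s"
    using calculation triangle_mono[of "Suc ?s" ?r] triangle_mono[of "Suc ?r" ?s] by linarith+
  ultimately show ?thesis by linarith
qed

lemma pfst_eq: "pfst z = z - triangle (triangle_root z)"
  using prod_encode_pfst_psnd[of z] by (simp add: prod_encode_def triangle_root_eq)

lemma psnd_eq: "psnd z = triangle_root z - pfst z"
  by (simp add: triangle_root_eq)

definition recf_root :: recf where
  "recf_root = Comp (Prec Zero (Comp recf_add [Proj 0, Comp recf_monus [Comp Succ [Zero],
     Comp recf_monus [Comp recf_triangle [Comp Succ [Proj 0]], Comp Succ [Proj 1]]]])) [Proj 0, Zero]"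

lemma evaluates_root: "evaluates recf_root [z] (triangle_root z)"
proof -
  have "evaluates (Prec Zero (Comp recf_add [Proj 0, Comp recf_monus [Comp Succ [Zero],
     Comp recf_monus [Comp recf_triangle [Comp Succ [Proj 0]], Comp Succ [Proj 1]]]])) [z, 0]
     (triangle_root z)"
  proof (induction z)
    case 0
    then show ?case by (auto intro: evaluates.Prec_0 evaluates_basic)
  next
    case (Suc z)
    show ?case
      unfolding triangle_root.simps One_nat_def
      by (rule evaluates.Prec_Suc[OF Suc[unfolded One_nat_def]])
        (blast intro: evaluates_basic[unfolded One_nat_def] evaluates_add evaluates_monus
          evaluates_triangle)
  qed
  then show ?thesis
    unfolding recf_root_def by (blast intro: evaluates_basic)
qed

text \<open>Only unary functions are considered; further arguments are packed by \<^const>\<open>prod_encode\<close>, so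
  that a bound variable and its environment turn into projections of a single number.\<close>

definition computable :: "(nat \<Rightarrow> nat) \<Rightarrow> bool" where
  "computable F \<longleftrightarrow> (\<exists>M. \<forall>x. evaluates M [x] (F x))"

lemma computableI: "(\<And>x. evaluates M [x] (F x)) \<Longrightarrow> computable F"
  unfolding computable_def by blast

lemma computable_comp: "computable F \<Longrightarrow> computable G \<Longrightarrow> computable (\<lambda>e. F (G e))"
  unfolding computable_def by (meson evaluates_Comp_1)

lemma computable_id: "computable (\<lambda>e. e)"
  by (rule computableI evaluates_Proj_0)+

lemma computable_Suc: "computable F \<Longrightarrow> computable (\<lambda>e. Suc (F e))"
  by (rule computable_comp[of Suc]) (auto intro: computableI evaluates.Succ)

lemma computable_const: "computable (\<lambda>e. k)"
proof (induction k)
  case 0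
  show ?case by (rule computableI evaluates.Zero)+
qed (rule computable_Suc)

lemma computable_pair:
  "computable F \<Longrightarrow> computable G \<Longrightarrow> computable (\<lambda>e. prod_encode (F e, G e))"
  unfolding computable_def by (meson evaluates_Comp_2 evaluates_pair)

lemma evaluates_pfst: "evaluates (Comp recf_monus [Proj 0, Comp recf_triangle [recf_root]]) [z] (pfst z)"
  unfolding pfst_eq
  by (blast intro: evaluates_basic evaluates_monus evaluates_triangle evaluates_root)

lemma computable_pfst: "computable F \<Longrightarrow> computable (\<lambda>e. pfst (F e))"
  by (rule computable_comp[of pfst]) (rule computableI, rule evaluates_pfst)

lemma computable_psnd: "computable F \<Longrightarrow> computable (\<lambda>e. psnd (F e))"
proof (rule computable_comp[of psnd])
  show "computable psnd"
    unfolding computable_def psnd_eq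
    by (meson evaluates_Comp_2 evaluates_monus evaluates_pfst evaluates_root)
qed

text \<open>This is the source of the arithmetic closure properties: an operation is rewritten as
  \<open>rec_nat\<close> with the environment \<open>e\<close> as a parameter. The step must be
  computable as a function of the single number that packs counter, previous value and environment,
  in this order.\<close>

lemma computable_rec_nat:
  assumes "computable A" "computable N"
    and "computable (\<lambda>e. S (pfst e) (pfst (psnd e)) (psnd (psnd e)))"
  shows "computable (\<lambda>e. rec_nat (A e) (\<lambda>n y. S n y e) (N e))"
proof -
  from assms obtain MA MN MS where MA: "\<And>x. evaluates MA [x] (A x)"
    and MN: "\<And>x. evaluates MN [x] (N x)"
    and MS: "\<And>x. evaluates MS [x] (S (pfst x) (pfst (psnd x)) (psnd (psnd x)))"
    unfolding computable_def by blast
  \<comment> \<open>\<open>Prec\<close> supplies the previous value before the counter; the inner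
    projections exchange the two while packing.\<close>
  define MG where "MG = Comp MS [Comp recf_pair [Proj 1, Comp recf_pair [Proj 0, Proj 2]]]"
  have G: "evaluates MG [y, n, x] (S n y x)" for y n x
    unfolding MG_def
  proof (rule evaluates_Comp_1)
    show "evaluates (Comp recf_pair [Proj 1, Comp recf_pair [Proj 0, Proj 2]]) [y, n, x]
        (prod_encode (n, prod_encode (y, x)))"
      by (blast intro: evaluates_basic evaluates_pair)
    show "evaluates MS [prod_encode (n, prod_encode (y, x))] (S n y x)"
      using MS[of "prod_encode (n, prod_encode (y, x))"] by simp
  qed
  have "evaluates (Prec MA MG) [n, x] (rec_nat (A x) (\<lambda>n y. S n y x) n)" for n x
    by (induction n) (auto intro: evaluates.Prec_0 evaluates.Prec_Suc MA G)
  then have "evaluates (Comp (Prec MA MG) [MN, Proj 0]) [x]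
      (rec_nat (A x) (\<lambda>n y. S n y x) (N x))" for x
    by (blast intro: evaluates_basic MN)
  then show ?thesis by (rule computableI)
qed

section \<open>Closure under arithmetic and iteration\<close>

named_theorems computable_intros

text \<open>The rules follow the syntax of the function body. \<open>computable_comp\<close> stays
  outside because its conclusion matches every goal; it is added only for specific
  functions.\<close>

lemmas [computable_intros] = computable_id computable_Suc computable_const computable_pair
  computable_pfst computable_psnd computable_rec_nat

lemma computable_add [computable_intros]:
  assumes "computable F" "computable G"
  shows "computable (\<lambda>e. F e + G e)"
proof -
  have "m + n = rec_nat m (\<lambda>_ y. Suc y) n" for m n :: nat
    by (induction n) auto
  then have eq: "F e + G e = rec_nat (F e) (\<lambda>_ y. Suc y) (G e)" for e .
  show ?thesis
    unfolding eq by (intro computable_intros assms)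
qed

lemma computable_diff [computable_intros]:
  assumes "computable F" "computable G"
  shows "computable (\<lambda>e. F e - G e)"
proof -
  have pred: "rec_nat 0 (\<lambda>m _. m) n = n - 1" for n :: nat
    by (cases n) auto
  have "m - n = rec_nat m (\<lambda>_ y. rec_nat 0 (\<lambda>m _. m) y) n" for m n :: nat
    by (induction n) (auto simp: pred)
  then have eq: "F e - G e = rec_nat (F e) (\<lambda>_ y. rec_nat 0 (\<lambda>m _. m) y) (G e)" for e .
  show ?thesis
    unfolding eq by (intro computable_intros assms)
qed

lemma computable_mult [computable_intros]:
  assumes "computable F" "computable G"
  shows "computable (\<lambda>e. F e * G e)"
proof -
  have "m * n = rec_nat 0 (\<lambda>_ y. y + m) n" for m n :: nat
    by (induction n) auto
  then have eq: "F e * G e = rec_nat 0 (\<lambda>_ y. y + F e) (G e)" for e .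
  \<comment> \<open>Inside the recursion step the environment is \<open>psnd (psnd e)\<close>, so
    \<open>F\<close> is needed composed with a projection.\<close>
  show ?thesis
    unfolding eq by (intro computable_intros computable_comp[OF assms(1)] assms)
qed

lemma computable_power [computable_intros]:
  assumes "computable F" "computable G"
  shows "computable (\<lambda>e. F e ^ G e)"
proof -
  have "m ^ n = rec_nat 1 (\<lambda>_ y. y * m) n" for m n :: nat
    by (induction n) auto
  then have eq: "F e ^ G e = rec_nat 1 (\<lambda>_ y. y * F e) (G e)" for e .
  show ?thesis
    unfolding eq by (intro computable_intros computable_comp[OF assms(1)] assms)
qed

lemma computable_sum [computable_intros]:
  assumes "computable N" "computable (\<lambda>e. F (pfst e) (psnd e))"
  shows "computable (\<lambda>e. \<Sum>i<N e. F i e)"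
proof -
  have eq: "(\<Sum>i<n. F i e) = rec_nat 0 (\<lambda>i y. y + F i e) n" for n e
    by (induction n) auto
  \<comment> \<open>The recursion step packs index, partial sum and environment; the summand skips
    the partial sum.\<close>
  have "computable (\<lambda>e. F (pfst e) (psnd (psnd e)))"
    using computable_comp[OF assms(2), of "\<lambda>e. prod_encode (pfst e, psnd (psnd e))"]
    by (simp add: computable_intros)
  then show ?thesis
    unfolding eq by (intro computable_intros assms)
qed

lemma computable_funpow:
  assumes "computable (\<lambda>e. F (pfst e) (psnd e))" "computable N" "computable A"
  shows "computable (\<lambda>e. ((\<lambda>x. F x e) ^^ N e) (A e))"
proof -
  have eq: "((\<lambda>x. F x e) ^^ n) a = rec_nat a (\<lambda>_ y. F y e) n" for n a e
    by (induction n) auto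
  have "computable (\<lambda>e. F (pfst (psnd e)) (psnd (psnd e)))"
    using computable_comp[OF assms(1), of "\<lambda>e. psnd e"] by (simp add: computable_intros)
  then show ?thesis
    unfolding eq by (intro computable_intros assms)
qed

section \<open>Decidable predicates and bounded quantifiers\<close>

definition computable_pred :: "(nat \<Rightarrow> bool) \<Rightarrow> bool" where
  "computable_pred P \<longleftrightarrow> computable (\<lambda>e. of_bool (P e))"

lemma computable_of_bool [computable_intros]:
  "computable_pred P \<Longrightarrow> computable (\<lambda>e. of_bool (P e))"
  by (simp add: computable_pred_def)

lemma computable_pred_le [computable_intros]:
  assumes "computable F" "computable G"
  shows "computable_pred (\<lambda>e. F e \<le> G e)"
proof -
  have "of_bool (m \<le> n) = 1 - (m - n)" for m n :: nat
    by auto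
  then have eq: "of_bool (F e \<le> G e) = 1 - (F e - G e)" for e .
  show ?thesis
    unfolding computable_pred_def eq by (intro computable_intros assms)
qed

lemma computable_pred_not [computable_intros]:
  assumes "computable_pred P"
  shows "computable_pred (\<lambda>e. \<not> P e)"
  proof -
  have eq: "of_bool (\<not> P e) = 1 - (of_bool (P e) :: nat)" for e
    by simp
  show ?thesis
    unfolding computable_pred_def eq by (intro computable_intros assms)
qed

lemma computable_pred_conj [computable_intros]:
  assumes "computable_pred P" "computable_pred Q"
  shows "computable_pred (\<lambda>e. P e \<and> Q e)"
  unfolding computable_pred_def of_bool_conj by (intro computable_intros assms)

lemma computable_pred_disj [computable_intros]:
  assumes "computable_pred P" "computable_pred Q"
  shows "computable_pred (\<lambda>e. P e \<or> Q e)"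
proof -
  have eq: "P e \<or> Q e \<longleftrightarrow> \<not> (\<not> P e \<and> \<not> Q e)" for e
    by blast
  show ?thesis
    unfolding eq by (intro computable_intros assms)
qed

lemma computable_pred_eq [computable_intros]:
  assumes "computable F" "computable G"
  shows "computable_pred (\<lambda>e. F e = G e)"
  unfolding eq_iff by (intro computable_intros assms)

lemma computable_pred_bex [computable_intros]:
  assumes "computable N" "computable_pred (\<lambda>e. P (pfst e) (psnd e))"
  shows "computable_pred (\<lambda>e. \<exists>i<N e. P i e)"
proof -
  have eq: "(\<exists>i<N e. P i e) \<longleftrightarrow> 1 \<le> (\<Sum>i<N e. of_bool (P i e) :: nat)" for e
    by (auto simp: Suc_le_eq sum_eq_0_iff simp flip: neq0_conv)
  show ?thesis
    unfolding eq by (intro computable_intros assms)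
qed

lemma computable_pred_ball [computable_intros]:
  assumes "computable N" "computable_pred (\<lambda>e. P (pfst e) (psnd e))"
  shows "computable_pred (\<lambda>e. \<forall>i<N e. P i e)"
proof -
  have eq: "(\<forall>i<N e. P i e) \<longleftrightarrow> \<not> (\<exists>i<N e. \<not> P i e)" for e
    by blast
  show ?thesis
    unfolding eq by (intro computable_intros assms)
qed

lemma computable_if [computable_intros]:
  assumes "computable_pred P" "computable F" "computable G"
  shows "computable (\<lambda>e. if P e then F e else G e)"
proof -
  have eq: "(if P e then F e else G e) = of_bool (P e) * F e + of_bool (\<not> P e) * G e" for e
    by simp
  show ?thesis
    unfolding eq by (intro computable_intros assms)
qed

lemma computable_div [computable_intros]:
  assumes "computable F" "computable G"
  shows "computable (\<lambda>e. F e div G e)"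
proof -
  \<comment> \<open>For positive \<open>n\<close> the quotient counts the positive multiples of
    \<open>n\<close> up to \<open>m\<close>, of which there are at most \<open>m\<close>. For
    \<open>n = 0\<close> every index would be counted, whereas \<open>m div 0 = 0\<close>.\<close>
  have "m div n = (if n = 0 then 0 else \<Sum>i<m. of_bool (Suc i * n \<le> m))" for m n :: nat
  proof (cases "n = 0")
    case False
    then have "Suc i * n \<le> m \<longleftrightarrow> i < m div n" for i
      by (simp add: less_eq_div_iff_mult_less_eq flip: Suc_le_eq)
    moreover have "{i. i < m \<and> i < m div n} = {..<m div n}"
      using div_le_dividend[of m n] less_le_trans by blast
    ultimately show ?thesis
      using False by (simp add: sum.If_cases of_bool_def Collect_conj_eq lessThan_def)
  qed simp
  then have eq: "F e div G e =
    (if G e = 0 then 0 else \<Sum>i<F e. of_bool (Suc i * G e \<le> F e))" for e .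
  show ?thesis
    unfolding eq
    by (intro computable_intros computable_comp[OF assms(1)] computable_comp[OF assms(2)] assms)
qed

lemma computable_pred_set_decode [computable_intros]:
  assumes "computable F" "computable G"
  shows "computable_pred (\<lambda>e. F e \<in> set_decode (G e))"
proof -
  \<comment> \<open>The remainder modulo 2 is rebuilt from division and subtraction, for which
    closure is known.\<close>
  have "odd m \<longleftrightarrow> m - 2 * (m div 2) = 1" for m :: nat
    unfolding minus_mult_div_eq_mod by (rule odd_iff_mod_2_eq_one)
  then have eq: "F e \<in> set_decode (G e) \<longleftrightarrow>
    G e div 2 ^ F e - 2 * (G e div 2 ^ F e div 2) = 1" for e
    unfolding set_decode_def mem_Collect_eq .
  show ?thesis
    unfolding eq by (intro computable_intros assms)
qed

section \<open>Coded lists\<close>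

text \<open>A nonempty list is coded by the successor of the pair of head and tail code. The code 0
  of the empty list is a fixed point of \<open>psnd (l - 1)\<close>, so dropping beyond the end
  stays at 0.\<close>

definition ldrop :: "nat \<Rightarrow> nat \<Rightarrow> nat" where
  "ldrop i k = ((\<lambda>l. psnd (l - 1)) ^^ i) k"

definition lhd :: "nat \<Rightarrow> nat" where
  "lhd k = pfst (k - 1)"

lemma computable_ldrop [computable_intros]:
  assumes "computable I" "computable K"
  shows "computable (\<lambda>e. ldrop (I e) (K e))"
  unfolding ldrop_def by (rule computable_funpow) (intro computable_intros assms)+

lemma computable_lhd [computable_intros]:
  "computable K \<Longrightarrow> computable (\<lambda>e. lhd (K e))"
  unfolding lhd_def by (intro computable_intros)

lemma list_encode_eq_0_iff [simp]: "list_encode xs = 0 \<longleftrightarrow> xs = []"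
  by (cases xs) auto

lemma ldrop_list_encode [simp]: "ldrop i (list_encode xs) = list_encode (drop i xs)"
proof (induction i)
  case (Suc i)
  have "drop (Suc i) xs = tl (drop i xs)"
    by (simp add: drop_Suc tl_drop)
  moreover have "psnd (list_encode ys - 1) = list_encode (tl ys)" for ys
    using psnd_le[of 0] by (cases ys) auto
  ultimately show ?case
    using Suc by (simp add: ldrop_def)
qed (simp add: ldrop_def)

lemma lhd_drop_list_encode: "i < length xs \<Longrightarrow> lhd (list_encode (drop i xs)) = xs ! i"
  by (simp add: lhd_def flip: Cons_nth_drop_Suc)

lemma length_le_list_encode: "length xs \<le> list_encode xs"
  by (induction xs) (auto intro: order_trans le_prod_encode_2)

lemma member_le_list_encode: "x \<in> set xs \<Longrightarrow> x \<le> list_encode xs"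
  by (induction xs) (auto intro: le_SucI order_trans le_prod_encode_1 le_prod_encode_2)

text \<open>Primitive recursion carries the table of all earlier values: each step conses
  \<open>G n y\<close> onto the coded list \<open>y\<close>. Consing puts the newest value in front,
  hence the reversed range.\<close>

lemma computable_course_of_values:
  assumes G: "computable (\<lambda>e. G (pfst e) (psnd e))"
    and g: "\<And>n. g n = G n (list_encode (map g (rev [0..<n])))"
  shows "computable g"
proof -
  let ?T = "\<lambda>n. rec_nat 0 (\<lambda>n y. Suc (prod_encode (G n y, y))) n"
  have table: "?T n = list_encode (map g (rev [0..<n]))" for n
    by (induction n) (simp_all flip: g)
  have G': "computable (\<lambda>e. G (pfst e) (pfst (psnd e)))"
    using computable_comp[OF G, of "\<lambda>e. prod_encode (pfst e, pfst (psnd e))"]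
    by (simp add: computable_intros)
  have "computable ?T"
    by (intro computable_intros G')
  then have "computable (\<lambda>n. prod_encode (n, ?T n))"
    by (rule computable_pair[OF computable_id])
  from computable_comp[OF G this] show ?thesis
    by (simp add: table flip: g)
qed

text \<open>In the table the value at \<open>i\<close> stands behind the values at the
  \<open>n - Suc i\<close> larger indices.\<close>

lemma lookup_course_of_values:
  assumes "i < n"
  shows "lhd (ldrop (n - Suc i) (list_encode (map g (rev [0..<n])))) = g i"
  using assms by (simp add: lhd_drop_list_encode rev_nth)

text \<open>This is \<open>list_all2\<close> on coded lists, for a relation given as a coded set of
  pairs. \<open>ldrop i k = 0\<close> means that position \<open>i\<close> does not exist;
  \<open>Suc (k + l)\<close> exceeds both lengths because a list code is at least the
  length.\<close>

definition coded_all2 :: "nat \<Rightarrow> nat \<Rightarrow> nat \<Rightarrow> bool" where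
  "coded_all2 W k l \<longleftrightarrow> (\<forall>i<Suc (k + l). ldrop i k = 0 \<and> ldrop i l = 0 \<or>
     (ldrop i k \<noteq> 0 \<and> ldrop i l \<noteq> 0 \<and>
      prod_encode (lhd (ldrop i k), lhd (ldrop i l)) \<in> set_decode W))"

lemma computable_pred_coded_all2 [computable_intros]:
  assumes "computable W" "computable K" "computable L"
  shows "computable_pred (\<lambda>e. coded_all2 (W e) (K e) (L e))"
  unfolding coded_all2_def
  by (intro computable_intros computable_comp[OF assms(1)] computable_comp[OF assms(2)]
      computable_comp[OF assms(3)])

lemma coded_all2_list_encode:
  "coded_all2 W (list_encode xs) (list_encode ys) \<longleftrightarrow>
     list_all2 (\<lambda>x y. prod_encode (x, y) \<in> set_decode W) xs ys"
proof -
  let ?Q = "\<lambda>i. length xs \<le> i \<and> length ys \<le> i \<or>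
    i < length xs \<and> i < length ys \<and> prod_encode (xs ! i, ys ! i) \<in> set_decode W"
  let ?N = "Suc (list_encode xs + list_encode ys)"
  have "coded_all2 W (list_encode xs) (list_encode ys) \<longleftrightarrow> (\<forall>i<?N. ?Q i)"
    unfolding coded_all2_def by (auto simp: lhd_drop_list_encode not_le)
  also have "\<dots> \<longleftrightarrow> list_all2 (\<lambda>x y. prod_encode (x, y) \<in> set_decode W) xs ys"
  proof
    assume Q: "\<forall>i<?N. ?Q i"
    have len: "length xs < ?N" "length ys < ?N"
      using length_le_list_encode[of xs] length_le_list_encode[of ys] by simp_all
    \<comment> \<open>At position \<open>length xs\<close> only the alternative that both lists have
      ended is possible; position \<open>length ys\<close> gives the other inequality.\<close>
    then have "length xs = length ys"
      using Q by (metis less_irrefl le_antisym)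
    moreover have "prod_encode (xs ! i, ys ! i) \<in> set_decode W" if "i < length xs" for i
      using Q that len by (meson less_trans not_le)
    ultimately show "list_all2 (\<lambda>x y. prod_encode (x, y) \<in> set_decode W) xs ys"
      by (simp add: list_all2_conv_all_nth)
  qed (auto simp: list_all2_conv_all_nth)
  finally show ?thesis .
qed


section \<open>Replacing variables by constants\<close>

definition freeze :: "nat \<Rightarrow> trm \<Rightarrow> trm" where
  "freeze c = subst (\<lambda>x. Fun (c + x) [])"

fun thaw :: "nat \<Rightarrow> trm \<Rightarrow> trm" where
  "thaw c (Var x) = Var x"
| "thaw c (Fun f ts) = (if c \<le> f then Var (f - c) else Fun f (map (thaw c) ts))"

lemma subst_Var [simp]: "subst Var t = t"
  by (induction t) (auto intro: map_idI)

lemma subst_subst: "subst \<sigma> (subst \<tau> t) = subst (\<lambda>x. subst \<sigma> (\<tau> x)) t"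
  by (induction t) auto

lemma subst_ground: "trm_vars t = {} \<Longrightarrow> subst \<sigma> t = t"
  by (induction t) (auto intro!: map_idI)

lemma thaw_subst:
  "fst ` trm_sign t \<subseteq> {..<c} \<Longrightarrow> thaw c (subst \<sigma> t) = subst (\<lambda>x. thaw c (\<sigma> x)) t"
  by (induction t) (auto simp: image_Un UN_subset_iff image_UN)

lemma thaw_freeze: "fst ` trm_sign t \<subseteq> {..<c} \<Longrightarrow> thaw c (freeze c t) = t"
  by (simp add: freeze_def thaw_subst)

lemma rstep_subst: "(s, t) \<in> rstep R \<Longrightarrow> (subst \<sigma> s, subst \<sigma> t) \<in> rstep R"
  by (induction rule: rstep.induct) (auto simp: subst_subst intro: rstep.intros)

lemma rsteps_subst: "(s, t) \<in> (rstep R)\<^sup>* \<Longrightarrow> (subst \<sigma> s, subst \<sigma> t) \<in> (rstep R)\<^sup>*"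
  by (induction rule: rtrancl_induct) (auto intro: rtrancl_into_rtrancl rstep_subst)

text \<open>The rules contain no symbol from \<open>c\<close> on, so a root step thaws to a root
  step with the thawed substitution. A step below a symbol \<open>f\<close> with
  \<open>c \<le> f\<close> vanishes, since \<open>thaw\<close> discards the arguments of
  \<open>f\<close>; hence the closure in the conclusion.\<close>

lemma rstep_thaw:
  assumes "(s, t) \<in> rstep R" and R: "fst ` sign R \<subseteq> {..<c}"
  shows "(thaw c s, thaw c t) \<in> (rstep R)\<^sup>*"
  using assms(1)
proof (induction rule: rstep.induct)
  case (root l r \<sigma>)
  then have "trm_sign l \<subseteq> sign R" "trm_sign r \<subseteq> sign R"
    by (auto simp: sign_def)
  then have "fst ` trm_sign l \<subseteq> {..<c}" "fst ` trm_sign r \<subseteq> {..<c}"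
    using R by blast+
  then show ?case
    using root by (auto simp: thaw_subst intro: rstep.root)
next
  case (ctxt s t f us vs)
  have "(Fun f (us' @ s' # vs'), Fun f (us' @ t' # vs')) \<in> (rstep R)\<^sup>*"
    if "(s', t') \<in> (rstep R)\<^sup>*" for s' t' us' vs'
    using that by (induction rule: rtrancl_induct) (auto intro: rtrancl_into_rtrancl rstep.ctxt)
  with ctxt show ?case by simp
qed

lemma rsteps_freeze_iff:
  assumes "fst ` sign R \<subseteq> {..<c}" "fst ` trm_sign p \<subseteq> {..<c}" "fst ` trm_sign q \<subseteq> {..<c}"
  shows "(freeze c p, freeze c q) \<in> (rstep R)\<^sup>* \<longleftrightarrow> (p, q) \<in> (rstep R)\<^sup>*"
proof
  assume "(freeze c p, freeze c q) \<in> (rstep R)\<^sup>*"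
  then have "(thaw c (freeze c p), thaw c (freeze c q)) \<in> (rstep R)\<^sup>*"
    by (induction rule: rtrancl_induct) (auto intro: rtrancl_trans rstep_thaw[OF _ assms(1)])
  then show "(p, q) \<in> (rstep R)\<^sup>*"
    using assms by (simp add: thaw_freeze)
qed (simp add: freeze_def rsteps_subst)

text \<open>The alphabet has to stay finite, so only variables below a bound \<open>n\<close>
  receive a constant.\<close>

definition fresh_constants :: "nat \<Rightarrow> nat \<Rightarrow> alphabet" where
  "fresh_constants c n = (\<lambda>i. (c + i, 0)) ` {..<n}"

lemma trm_encode_arg_le: "t \<in> set ts \<Longrightarrow> trm_encode t \<le> trm_encode (Fun f ts)"
  using member_le_list_encode[of "trm_encode t" "map trm_encode ts"]
  by (auto intro: order_trans le_prod_encode_2)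

text \<open>This spares computing the variables of a term: the bound on the fresh constants is read
  off its code.\<close>

lemma trm_vars_le_trm_encode: "x \<in> trm_vars t \<Longrightarrow> x \<le> trm_encode t"
proof (induction t)
  case (Var x)
  then show ?case using le_prod_encode_2[of x 0] by simp
next
  case (Fun f ts)
  then obtain t where "t \<in> set ts" "x \<le> trm_encode t" by auto
  then show ?case using trm_encode_arg_le order_trans by blast
qed

lemma trm_sign_subst:
  "trm_sign (subst \<sigma> t) = trm_sign t \<union> (\<Union>x \<in> trm_vars t. trm_sign (\<sigma> x))"
  by (induction t) auto

lemma trm_vars_subst: "trm_vars (subst \<sigma> t) = (\<Union>x \<in> trm_vars t. trm_vars (\<sigma> x))"
  by (induction t) auto

lemma freeze_ground_terms:
  assumes "t \<in> terms \<Sigma>" and "trm_encode t < n"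
  shows "freeze c t \<in> ground_terms (\<Sigma> \<union> fresh_constants c n)"
  using assms trm_vars_le_trm_encode[of _ t]
  by (fastforce simp: ground_terms_def terms_def freeze_def trm_sign_subst trm_vars_subst
      fresh_constants_def)

section \<open>Freezing on codes\<close>

text \<open>For a compound term, the code of the argument list is strictly smaller than the term
  code, so recursion on codes terminates. For variables equality can occur, as in
  \<open>prod_encode (0, 1) = 1\<close>.\<close>

lemma psnd_less:
  assumes "pfst n \<noteq> 0"
  shows "psnd n < n"
proof -
  obtain f where f: "pfst n = Suc f"
    using assms not0_implies_Suc by blast
  have "psnd n \<le> triangle (Suc (f + psnd n))"
    using le_prod_encode_2[of "psnd n" f] by (simp add: prod_encode_def)
  also have "\<dots> < prod_encode (Suc f, psnd n)"
    by (simp add: prod_encode_def)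
  finally show ?thesis
    using f by (metis prod_encode_pfst_psnd)
qed

text \<open>A first component 0 marks a variable, and \<open>prod_encode (Suc (c + x), 0)\<close> is
  the code of the constant \<open>c + x\<close>, with 0 for the empty argument list. The second
  function treats codes of argument lists.\<close>

function freeze_code :: "nat \<Rightarrow> nat \<Rightarrow> nat" and freeze_codes :: "nat \<Rightarrow> nat \<Rightarrow> nat" where
  "freeze_code c n =
     (if pfst n = 0 then prod_encode (Suc (c + psnd n), 0)
      else prod_encode (pfst n, freeze_codes c (psnd n)))"
| "freeze_codes c k =
     (if k = 0 then 0
      else Suc (prod_encode (freeze_code c (pfst (k - 1)), freeze_codes c (psnd (k - 1)))))"
  by pat_completeness auto
termination
proof (relation "measure (case_sum snd snd)")
  show "pfst n \<noteq> 0 \<Longrightarrow> (Inr (c, psnd n), Inl (c, n)) \<in> measure (case_sum snd snd)" for c n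
    by (simp add: psnd_less)
  show "k \<noteq> 0 \<Longrightarrow> (Inl (c, pfst (k - 1)), Inr (c, k)) \<in> measure (case_sum snd snd)"
    "k \<noteq> 0 \<Longrightarrow> (Inr (c, psnd (k - 1)), Inr (c, k)) \<in> measure (case_sum snd snd)" for c k
    using pfst_le[of "k - 1"] psnd_le[of "k - 1"] by simp_all
qed simp

declare freeze_code.simps [simp del] freeze_codes.simps [simp del]

lemma freeze_code_trm_encode: "freeze_code c (trm_encode t) = trm_encode (freeze c t)"
proof (induction t)
  case (Var x)
  then show ?case by (simp add: freeze_code.simps freeze_def)
next
  case (Fun f ts)
  then have "freeze_codes c (list_encode (map trm_encode ts)) =
    list_encode (map (\<lambda>t. trm_encode (freeze c t)) ts)"
    by (induction ts) (simp_all add: freeze_codes.simps)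
  then show ?case by (simp add: freeze_code.simps freeze_def comp_def)
qed

text \<open>The mutual recursion becomes a single course-of-values recursion by tabulating pairs of
  values. In every selected branch the lookups are at smaller numbers.\<close>

lemma computable_freeze_code [computable_intros]:
  assumes "computable F"
  shows "computable (\<lambda>e. freeze_code c (F e))"
proof -
  define look where "look n h i = lhd (ldrop (n - Suc i) h)" for n h i
  define G where "G n h = prod_encode
    (if pfst n = 0 then prod_encode (Suc (c + psnd n), 0)
       else prod_encode (pfst n, psnd (look n h (psnd n))),
     if n = 0 then 0
       else Suc (prod_encode (pfst (look n h (pfst (n - 1))), psnd (look n h (psnd (n - 1))))))"
    for n h
  let ?g = "\<lambda>n. prod_encode (freeze_code c n, freeze_codes c n)"
  have "computable ?g"
  proof (rule computable_course_of_values)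
    show "computable (\<lambda>e. G (pfst e) (psnd e))"
      unfolding G_def look_def by (intro computable_intros)
    fix n
    let ?h = "list_encode (map ?g (rev [0..<n]))"
    have look: "look n ?h i = ?g i" if "i < n" for i
      unfolding look_def using that by (rule lookup_course_of_values)
    have "pfst (n - 1) < n" "psnd (n - 1) < n" if "n \<noteq> 0"
      using that pfst_le[of "n - 1"] psnd_le[of "n - 1"] by simp_all
    then show "?g n = G n ?h"
      using pfst_le[of 0] by (simp add: G_def look psnd_less freeze_code.simps[of c n] freeze_codes.simps[of c n])
  qed
  from computable_comp[OF computable_pfst[OF this] assms] show ?thesis
    by simp
qed


section \<open>Runs of tree automata\<close>

text \<open>Reading states as constants, a run applies the rules only to subterms whose arguments have
  been processed; \<open>cong\<close> without arguments makes every constant a run to itself.\<close>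

inductive run :: "rule set \<Rightarrow> trm \<Rightarrow> trm \<Rightarrow> bool" for \<Delta> where
  cong: "list_all2 (run \<Delta>) ts us \<Longrightarrow> run \<Delta> (Fun f ts) (Fun f us)"
| step: "run \<Delta> t l \<Longrightarrow> (l, r) \<in> \<Delta> \<Longrightarrow> run \<Delta> t r"

lemma rsteps_args:
  assumes "list_all2 (\<lambda>t u. (t, u) \<in> (rstep R)\<^sup>*) ts us"
  shows "(Fun f (vs @ ts), Fun f (vs @ us)) \<in> (rstep R)\<^sup>*"
  using assms
proof (induction arbitrary: vs rule: list_all2_induct)
  case (Cons t ts u us)
  from Cons.hyps(1) have "(Fun f (vs @ t # ts), Fun f (vs @ u # ts)) \<in> (rstep R)\<^sup>*"
    by (induction rule: rtrancl_induct) (auto intro: rtrancl_into_rtrancl rstep.ctxt)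
  also have "(Fun f (vs @ u # ts), Fun f (vs @ u # us)) \<in> (rstep R)\<^sup>*"
    using Cons.IH[of "vs @ [u]"] by simp
  finally show ?case .
qed simp

lemma run_imp_rsteps: "run \<Delta> t u \<Longrightarrow> (t, u) \<in> (rstep \<Delta>)\<^sup>*"
proof (induction rule: run.induct)
  case (cong ts us f)
  then have "list_all2 (\<lambda>t u. (t, u) \<in> (rstep \<Delta>)\<^sup>*) ts us"
    by (rule list_all2_mono) simp
  from rsteps_args[OF this, of f "[]"] show ?case by simp
next
  case (step t l r)
  then show ?case
    using rstep.root[of l r \<Delta> Var] by (simp add: rtrancl_into_rtrancl)
qed

lemma run_refl: "trm_vars t = {} \<Longrightarrow> run \<Delta> t t"
  by (induction t) (auto intro!: run.cong list.rel_refl_strong)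

text \<open>A run from a constant is a trivial \<open>cong\<close> followed by uses of
  \<open>step\<close> only, and these can be appended to any run that ends in the constant.\<close>

lemma run_trans_const: "run \<Delta> (Fun a []) u \<Longrightarrow> run \<Delta> s (Fun a []) \<Longrightarrow> run \<Delta> s u"
  by (induction "Fun a []" u rule: run.induct) (auto intro: run.step)

text \<open>A run from a compound term begins with \<open>cong\<close>, which uses the argument
  \<open>t\<close> only through a term that \<open>t\<close> runs to; the later uses of
  \<open>step\<close> are kept.\<close>

lemma run_ctxt:
  assumes "run \<Delta> (Fun f (us @ t # vs)) u" and "\<And>u. run \<Delta> t u \<Longrightarrow> run \<Delta> s u"
  shows "run \<Delta> (Fun f (us @ s # vs)) u"
  using assms(1)
proof (induction "Fun f (us @ t # vs)" u rule: run.induct)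
  case (cong ws)
  then have "list_all2 (run \<Delta>) (us @ t # vs) ws"
    by (auto elim: list_all2_mono)
  then obtain us' t' vs' where "ws = us' @ t' # vs'" "list_all2 (run \<Delta>) us us'"
    "run \<Delta> t t'" "list_all2 (run \<Delta>) vs vs'"
    by (auto simp: list_all2_append1 list_all2_Cons1)
  then have "list_all2 (run \<Delta>) (us @ s # vs) ws"
    using assms(2) by (auto intro: list_all2_appendI)
  then show ?case by (rule run.cong)
qed (rule run.step)

text \<open>Runs absorb a preceding rewrite step, so a rewrite sequence is consumed from its end.
  For a root step, groundness of \<open>l\<close> removes the substitution, and the constant
  \<open>r\<close> allows composition.\<close>

lemma run_iff_rsteps:
  assumes \<Delta>: "\<And>l r. (l, r) \<in> \<Delta> \<Longrightarrow> trm_vars l = {} \<and> (\<exists>a. r = Fun a [])"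
  shows "run \<Delta> t (Fun a []) \<longleftrightarrow> (t, Fun a []) \<in> (rstep \<Delta>)\<^sup>*"
proof
  have backward: "run \<Delta> s u" if "(s, t) \<in> rstep \<Delta>" "run \<Delta> t u" for s t u
    using that
  proof (induction arbitrary: u rule: rstep.induct)
    case (root l r \<sigma>)
    then obtain a where r: "r = Fun a []" and l: "trm_vars l = {}"
      using \<Delta> by blast
    have "run \<Delta> l r"
      using run_refl[OF l] root(1) by (rule run.step)
    with root r l show ?case
      by (auto simp: subst_ground intro: run_trans_const)
  next
    case (ctxt s t f us vs)
    then show ?case by (blast intro: run_ctxt)
  qed
  assume "(t, Fun a []) \<in> (rstep \<Delta>)\<^sup>*"
  then show "run \<Delta> t (Fun a [])"
    by (induction rule: converse_rtrancl_induct) (auto intro: run_refl backward)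
qed (rule run_imp_rsteps)


section \<open>Deciding membership in the language of a tree automaton\<close>

lemma set_decode_less: "x \<in> set_decode n \<Longrightarrow> x < n"
proof -
  assume "x \<in> set_decode n"
  then have "n div 2 ^ x \<noteq> 0"
    unfolding set_decode_def by (metis even_zero mem_Collect_eq)
  then have "2 ^ x \<le> n"
    by (metis div_less not_le)
  then show ?thesis
    using less_exp[of x] by (rule less_le_trans[rotated])
qed

text \<open>The sum writes the set in binary, which turns bounded comprehension into a computable
  operation on coded sets.\<close>

lemma set_decode_sum: "set_decode (\<Sum>x<n. of_bool (P x) * 2 ^ x) = {x. x < n \<and> P x}"
proof -
  have "(\<Sum>x<n. of_bool (P x) * 2 ^ x) = set_encode {x. x < n \<and> P x}"
    unfolding set_encode_def
    by (rule sum.mono_neutral_cong_right) (auto simp: of_bool_def)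
  then show ?thesis by simp
qed

text \<open>\<open>D\<close> codes a set of rules, \<open>W\<close> a set of coded pairs of coded terms, and the three disjuncts
  are: already present, \<open>cong\<close>, \<open>step\<close>. Keeping the old pairs makes the iteration increasing, so it
  is stationary after \<open>B + 1\<close> rounds.\<close>

definition saturate :: "nat \<Rightarrow> nat \<Rightarrow> nat \<Rightarrow> nat" where
  "saturate D B W = (\<Sum>x<B. of_bool (x \<in> set_decode W \<or>
     (pfst (pfst x) = pfst (psnd x) \<and> coded_all2 W (psnd (pfst x)) (psnd (psnd x))) \<or>
     (\<exists>l<D. prod_encode (l, psnd x) \<in> set_decode D \<and>
            prod_encode (pfst x, l) \<in> set_decode W)) * 2 ^ x)"

definition saturation :: "nat \<Rightarrow> nat \<Rightarrow> nat" where
  "saturation D B = (saturate D B ^^ Suc B) 0"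

lemma computable_saturation [computable_intros]:
  assumes D: "computable D" and B: "computable B"
  shows "computable (\<lambda>e. saturation (D e) (B e))"
  unfolding saturation_def
proof (rule computable_funpow)
  show "computable (\<lambda>e. saturate (D (psnd e)) (B (psnd e)) (pfst e))"
    unfolding saturate_def
    by (intro computable_intros computable_comp[OF D] computable_comp[OF B])
qed (intro computable_intros B)+

text \<open>The bound \<open>l < D\<close> in \<open>saturate\<close> loses nothing: a member of the
  set coded by \<open>D\<close> is below \<open>D\<close>, and a pair code is at least its first
  component.\<close>

lemma prod_encode_in_set_decode_saturate:
  "prod_encode (t, u) \<in> set_decode (saturate D B W) \<longleftrightarrow> prod_encode (t, u) < B \<and>
     (prod_encode (t, u) \<in> set_decode W \<or> (pfst t = pfst u \<and> coded_all2 W (psnd t) (psnd u)) \<or>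
      (\<exists>l. prod_encode (l, u) \<in> set_decode D \<and> prod_encode (t, l) \<in> set_decode W))"
proof -
  have "l < D" if "prod_encode (l, u) \<in> set_decode D" for l
    using set_decode_less[OF that] le_prod_encode_1[of l u] by simp
  then show ?thesis
    unfolding saturate_def set_decode_sum by auto
qed

lemma set_decode_saturate:
  "set_decode (saturate D B W) \<subseteq> {..<B}"
  "set_decode W \<inter> {..<B} \<subseteq> set_decode (saturate D B W)"
  unfolding saturate_def set_decode_sum by auto

lemma saturate_saturation: "saturate D B (saturation D B) = saturation D B"
proof -
  define W where "W k = (saturate D B ^^ k) 0" for k
  have W_0: "W 0 = 0" and W_Suc: "W (Suc k) = saturate D B (W k)" for k
    by (simp_all add: W_def)
  have bound: "set_decode (W k) \<subseteq> {..<B}" for k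
    by (cases k) (simp_all add: W_0 W_Suc set_decode_saturate(1))
  then have inflate: "set_decode (W k) \<subseteq> set_decode (W (Suc k))" for k
    using set_decode_saturate(2)[of "W k" B D] unfolding W_Suc by blast
  \<comment> \<open>Until the sequence becomes stationary each round gains an element. For
    \<open>k = Suc B\<close> the first alternative would exceed the \<open>B\<close> available
    elements.\<close>
  have "k \<le> card (set_decode (W k)) \<or> W (Suc k) = W k" for k
  proof (induction k)
    case (Suc k)
    show ?case
    proof (cases "W (Suc k) = W k")
      case True
      then show ?thesis by (simp add: W_Suc)
    next
      case False
      then have "set_decode (W k) \<noteq> set_decode (W (Suc k))"
        using set_decode_inverse by metis
      then have "card (set_decode (W k)) < card (set_decode (W (Suc k)))"
        using inflate by (intro psubset_card_mono) auto
      then show ?thesis using Suc False by linarith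
    qed
  qed simp
  moreover have "card (set_decode (W (Suc B))) \<le> B"
    using card_mono[OF _ bound] by simp
  ultimately have "W (Suc (Suc B)) = W (Suc B)"
    using not_less_eq_eq by blast
  moreover have "saturation D B = W (Suc B)"
    by (simp only: W_def saturation_def)
  ultimately show ?thesis
    using W_Suc[of "Suc B"] by argo
qed

lemma prod_encode_in_rules_encode:
  assumes "finite \<Delta>"
  shows "prod_encode (x, y) \<in> set_decode (rules_encode \<Delta>) \<longleftrightarrow>
    (\<exists>(l, r) \<in> \<Delta>. x = trm_encode l \<and> y = trm_encode r)"
proof -
  have "prod_encode (x, y) \<in> (\<lambda>(l, r). prod_encode (trm_encode l, trm_encode r)) ` \<Delta> \<longleftrightarrow>
      (\<exists>(l, r) \<in> \<Delta>. x = trm_encode l \<and> y = trm_encode r)"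
    unfolding image_iff by (rule bex_cong) auto
  then show ?thesis
    using assms by (simp add: rules_encode_def)
qed

text \<open>Soundness, by induction on the rounds. The disjunct for \<open>cong\<close> compares
  first components, which are 0 for all variables, and could relate variables whose indices code
  suitable lists; groundness of \<open>t\<close> excludes this.\<close>

lemma saturation_imp_run:
  assumes \<Delta>: "finite \<Delta>" and "trm_vars t = {}"
    and "prod_encode (trm_encode t, trm_encode u) \<in> set_decode (saturation (rules_encode \<Delta>) B)"
  shows "run \<Delta> t u"
proof -
  have "prod_encode (trm_encode t, trm_encode u) \<in>
      set_decode ((saturate (rules_encode \<Delta>) B ^^ k) 0) \<Longrightarrow> trm_vars t = {} \<Longrightarrow> run \<Delta> t u" for k
  proof (induction k arbitrary: t u)
    case (Suc k)
    let ?W = "(saturate (rules_encode \<Delta>) B ^^ k) 0"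
    from Suc.prems(1) consider
        "prod_encode (trm_encode t, trm_encode u) \<in> set_decode ?W"
      | "pfst (trm_encode t) = pfst (trm_encode u)"
        "coded_all2 ?W (psnd (trm_encode t)) (psnd (trm_encode u))"
      | l where "prod_encode (l, trm_encode u) \<in> set_decode (rules_encode \<Delta>)"
        "prod_encode (trm_encode t, l) \<in> set_decode ?W"
      by (auto simp: prod_encode_in_set_decode_saturate)
    then show ?case
    proof cases
      case 1
      then show ?thesis using Suc by blast
    next
      case 2
      obtain f ts where t: "t = Fun f ts" using Suc.prems(2) by (cases t) auto
      with 2(1) obtain us where u: "u = Fun f us" by (cases u) auto
      have "list_all2 (run \<Delta>) ts us"
        using 2(2) Suc.prems(2) unfolding t u
        by (auto simp: coded_all2_list_encode list_all2_conv_all_nth intro!: Suc.IH)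
      then show ?thesis unfolding t u by (rule run.cong)
    next
      case 3
      then obtain l' where "(l', u) \<in> \<Delta>" "l = trm_encode l'"
        by (auto simp: prod_encode_in_rules_encode[OF \<Delta>] trm_encode_eq_iff)
      then show ?thesis using 3 Suc by (blast intro: run.step)
    qed
  qed simp
  then show ?thesis
    using assms unfolding saturation_def by blast
qed

lemma prod_encode_mono:
  assumes "a \<le> c" "b \<le> d"
  shows "prod_encode (a, b) \<le> prod_encode (c, d)"
  using assms triangle_mono[of "a + b" "c + d"] by (simp add: prod_encode_def)

text \<open>Completeness: the bounds pass to all premises of a run. Arguments do not have larger
  codes than their term, and the left-hand side used by \<open>step\<close> is below the code of the
  rules, so the whole derivation fits into the table.\<close>

lemma run_imp_saturation:
  assumes \<Delta>: "finite \<Delta>" and "run \<Delta> t u"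
    and "trm_encode t \<le> m" "trm_encode u \<le> n" "rules_encode \<Delta> \<le> n"
  shows "prod_encode (trm_encode t, trm_encode u) \<in>
    set_decode (saturation (rules_encode \<Delta>) (Suc (prod_encode (m, n))))"
    (is "_ \<in> set_decode ?W")
proof -
  \<comment> \<open>Unfolding the fixed point once reduces membership of a pair to membership of its
    premises.\<close>
  have closed: "prod_encode (trm_encode t, trm_encode u) \<in> set_decode ?W"
    if "trm_encode t \<le> m" "trm_encode u \<le> n"
      "pfst (trm_encode t) = pfst (trm_encode u) \<and>
         coded_all2 ?W (psnd (trm_encode t)) (psnd (trm_encode u)) \<or>
       (\<exists>l. prod_encode (l, trm_encode u) \<in> set_decode (rules_encode \<Delta>) \<and>
          prod_encode (trm_encode t, l) \<in> set_decode ?W)" for t u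
    by (subst saturate_saturation[symmetric])
      (use that prod_encode_mono in \<open>simp add: prod_encode_in_set_decode_saturate less_Suc_eq_le\<close>)
  from assms(2-4) show ?thesis
  proof (induction rule: run.induct)
    case (cong ts us f)
    have "trm_encode x \<le> m" if "x \<in> set ts" for x
      using trm_encode_arg_le[OF that] cong.prems(1) by (rule order_trans)
    moreover have "trm_encode x \<le> n" if "x \<in> set us" for x
      using trm_encode_arg_le[OF that] cong.prems(2) by (rule order_trans)
    ultimately have "coded_all2 ?W (list_encode (map trm_encode ts)) (list_encode (map trm_encode us))"
      using cong.IH by (auto simp: coded_all2_list_encode list_all2_conv_all_nth)
    with cong.prems show ?case by (intro closed) simp_all
  next
    case (step t l r)
    then have lr: "prod_encode (trm_encode l, trm_encode r) \<in> set_decode (rules_encode \<Delta>)"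
      by (auto simp: prod_encode_in_rules_encode[OF \<Delta>])
    then have "trm_encode l \<le> n"
      using set_decode_less[OF lr] le_prod_encode_1[of "trm_encode l" "trm_encode r"] assms(5)
      by linarith
    with step lr show ?case by (blast intro: closed)
  qed
qed

text \<open>Here \<open>pfst (psnd C)\<close> codes the final states, \<open>psnd (psnd C)\<close>
  the rules, and \<open>prod_encode (Suc a, 0)\<close> the constant for state \<open>a\<close>. The
  pair in the bound dominates both the rule code and these constants, because \<open>a\<close> is
  below the code of the final states.\<close>

definition accepts_code :: "nat \<Rightarrow> nat \<Rightarrow> bool" where
  "accepts_code C t \<longleftrightarrow> (\<exists>a<pfst (psnd C). a \<in> set_decode (pfst (psnd C)) \<and>
     prod_encode (t, prod_encode (Suc a, 0)) \<in> set_decode (saturation (psnd (psnd C))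
       (Suc (prod_encode (t, prod_encode (Suc (pfst (psnd C)), psnd (psnd C)))))))"

lemma computable_pred_accepts_code: "computable_pred (\<lambda>e. accepts_code (pfst e) (psnd e))"
  unfolding accepts_code_def by (intro computable_intros)

lemma accepts_code_iff:
  assumes C: "is_bta \<Sigma> C" and t: "t \<in> ground_terms \<Sigma>"
  shows "accepts_code (bta_encode C) (trm_encode t) \<longleftrightarrow> t \<in> bta_lang \<Sigma> C"
proof -
  have fin: "finite (finals C)" and \<Delta>: "finite (rules C)"
    using C finite_subset by (auto simp: is_bta_def)
  have shape: "trm_vars l = {} \<and> (\<exists>a. r = Fun a [])" if "(l, r) \<in> rules C" for l r
    using C that by (auto simp: is_bta_def state_trm_def)
  let ?F = "set_encode (finals C)" and ?D = "rules_encode (rules C)"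
  let ?n = "prod_encode (Suc ?F, ?D)"
  let ?W = "saturation ?D (Suc (prod_encode (trm_encode t, ?n)))"
  have finals: "a < ?F" if "a \<in> finals C" for a
    using set_decode_less[of a ?F] that fin by simp
  have "prod_encode (trm_encode t, trm_encode (Fun a [])) \<in> set_decode ?W \<longleftrightarrow>
      (t, Fun a []) \<in> (rstep (rules C))\<^sup>*" if "a \<in> finals C" for a
  proof -
    have "trm_encode (Fun a []) \<le> ?n"
      using finals[OF that] by (simp add: prod_encode_mono)
    then have "run (rules C) t (Fun a []) \<Longrightarrow>
        prod_encode (trm_encode t, trm_encode (Fun a [])) \<in> set_decode ?W"
      by (intro run_imp_saturation[OF \<Delta>]) (auto intro: le_prod_encode_2)
    moreover have "trm_vars t = {}"
      using t by (simp add: ground_terms_def)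
    ultimately show ?thesis
      using saturation_imp_run[OF \<Delta>] run_iff_rsteps[OF shape] by blast
  qed
  then show ?thesis
    using t fin finals
    by (auto simp: accepts_code_def bta_encode_def bta_lang_def state_trm_def)
qed

section \<open>Assembling the decision procedure\<close>

text \<open>Codes of disjoint finite sets add up, so the extended alphabet costs a fixed number plus
  a sum computable from \<open>n\<close>.\<close>

lemma alphabet_encode_fresh_constants:
  assumes "finite \<Sigma>" "fst ` \<Sigma> \<subseteq> {..<c}"
  shows "alphabet_encode (\<Sigma> \<union> fresh_constants c n) =
    alphabet_encode \<Sigma> + (\<Sum>i<n. 2 ^ prod_encode (c + i, 0))"
proof -
  have "inj_on (\<lambda>i. prod_encode (c + i, 0)) {..<n}"
    by (auto intro!: inj_onI)
  then have "set_encode (prod_encode ` fresh_constants c n) = (\<Sum>i<n. 2 ^ prod_encode (c + i, 0))"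
    by (simp add: set_encode_def fresh_constants_def image_image sum.reindex)
  moreover have "prod_encode ` \<Sigma> \<inter> prod_encode ` fresh_constants c n = {}"
    using assms(2) by (auto simp: fresh_constants_def)
  moreover have "finite (prod_encode ` \<Sigma>)" "finite (prod_encode ` fresh_constants c n)"
    using assms(1) by (simp_all add: fresh_constants_def)
  moreover have "set_encode (A \<union> B) = set_encode A + set_encode B"
    if "A \<inter> B = {}" "finite A" "finite B" for A B
    unfolding set_encode_def using that by (rule sum.union_disjoint[rotated 2])
  ultimately show ?thesis
    unfolding alphabet_encode_def image_Un by metis
qed

theorem mainTheorem2:
  fixes \<Sigma> :: alphabet and R :: "rule set"
  assumes "ranked_alphabet \<Sigma>" and "trs \<Sigma> R" and "eprf R"
  shows "decidable (terms \<Sigma> \<times> terms \<Sigma>)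
           (\<lambda>(p, q). [trm_encode p, trm_encode q])
           (\<lambda>(p, q). (p, q) \<in> (rstep R)\<^sup>*)"
proof -
  have \<Sigma>: "finite \<Sigma>" "single_valued \<Sigma>"
    using assms(1) by (auto simp: ranked_alphabet_def)
  then have "finite (fst ` \<Sigma>)" by simp
  then obtain c where "\<forall>n \<in> fst ` \<Sigma>. n < c"
    unfolding finite_nat_set_iff_bounded by blast
  then have c: "fst ` \<Sigma> \<subseteq> {..<c}" by blast
  have "trm_sign l \<subseteq> \<Sigma> \<and> trm_sign r \<subseteq> \<Sigma>" if "(l, r) \<in> R" for l r
    using assms(2) that by (auto simp: trs_def terms_def)
  then have R: "sign R \<subseteq> \<Sigma>"
    by (auto simp: sign_def)
  from assms(3) obtain M where M: "\<And>\<Sigma> L. ranked_alphabet \<Sigma> \<Longrightarrow> sign R \<subseteq> \<Sigma> \<Longrightarrow> finite L \<Longrightarrow>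
      L \<subseteq> ground_terms \<Sigma> \<Longrightarrow> \<exists>C. is_bta \<Sigma> C \<and> bta_lang \<Sigma> C = descendants R L \<and>
        evaluates M [alphabet_encode \<Sigma>, trms_encode L] (bta_encode C)"
    unfolding eprf_def by (elim exE) blast
  \<comment> \<open>The number \<open>e\<close> packs the codes of the two terms; the successor of
    their sum exceeds both and hence all variables involved.\<close>
  have "computable (\<lambda>e. alphabet_encode \<Sigma> +
      (\<Sum>i<Suc (pfst e + psnd e). 2 ^ prod_encode (c + i, 0)))"
    by (intro computable_intros)
  then obtain mA where mA: "\<And>e. evaluates mA [e] (alphabet_encode \<Sigma> +
      (\<Sum>i<Suc (pfst e + psnd e). 2 ^ prod_encode (c + i, 0)))"
    unfolding computable_def by blast
  have "computable (\<lambda>e. 2 ^ freeze_code c (pfst e))"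
    by (intro computable_intros)
  then obtain mL where mL: "\<And>e. evaluates mL [e] (2 ^ freeze_code c (pfst e))"
    unfolding computable_def by blast
  have "computable (\<lambda>e. freeze_code c (psnd e))"
    by (intro computable_intros)
  then obtain mQ where mQ: "\<And>e. evaluates mQ [e] (freeze_code c (psnd e))"
    unfolding computable_def by blast
  obtain mD where mD: "\<And>e. evaluates mD [e] (of_bool (accepts_code (pfst e) (psnd e)))"
    using computable_pred_accepts_code unfolding computable_pred_def computable_def by blast
  let ?M = "Comp mD [Comp recf_pair [Comp M [Comp mA [recf_pair], Comp mL [recf_pair]],
      Comp mQ [recf_pair]]]"
  have correct: "evaluates ?M [trm_encode p, trm_encode q] (of_bool ((p, q) \<in> (rstep R)\<^sup>*))"
    if p: "p \<in> terms \<Sigma>" and q: "q \<in> terms \<Sigma>" for p q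
  proof -
    let ?n = "Suc (trm_encode p + trm_encode q)"
    let ?\<Sigma> = "\<Sigma> \<union> fresh_constants c ?n"
    \<comment> \<open>No rank conflict arises: the new names start at \<open>c\<close>, above all
      old ones, and all have rank 0.\<close>
    have "ranked_alphabet ?\<Sigma>"
      using \<Sigma> c unfolding ranked_alphabet_def
      by (fastforce simp: fresh_constants_def intro!: single_valuedI dest: single_valuedD)
    moreover have pq: "freeze c p \<in> ground_terms ?\<Sigma>" "freeze c q \<in> ground_terms ?\<Sigma>"
      using p q by (auto intro: freeze_ground_terms)
    ultimately obtain C where C: "is_bta ?\<Sigma> C" "bta_lang ?\<Sigma> C = descendants R {freeze c p}"
      and mC: "evaluates M [alphabet_encode ?\<Sigma>, trms_encode {freeze c p}] (bta_encode C)"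
      using M[of ?\<Sigma> "{freeze c p}"] R by blast
    have "accepts_code (bta_encode C) (trm_encode (freeze c q)) \<longleftrightarrow>
        freeze c q \<in> descendants R {freeze c p}"
      using accepts_code_iff[OF C(1) pq(2)] C(2) by simp
    also have "\<dots> \<longleftrightarrow> (p, q) \<in> (rstep R)\<^sup>*"
    proof -
      have "fst ` sign R \<subseteq> {..<c}" "fst ` trm_sign p \<subseteq> {..<c}" "fst ` trm_sign q \<subseteq> {..<c}"
        using c R p q unfolding terms_def by blast+
      then show ?thesis
        by (simp add: descendants_def rsteps_freeze_iff)
    qed
    finally have accepts: "accepts_code (bta_encode C) (trm_encode (freeze c q)) \<longleftrightarrow>
        (p, q) \<in> (rstep R)\<^sup>*" .
    let ?e = "prod_encode (trm_encode p, trm_encode q)"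
    have "evaluates mA [?e] (alphabet_encode ?\<Sigma>)"
      using mA[of ?e] by (simp add: alphabet_encode_fresh_constants[OF \<Sigma>(1) c])
    note A = evaluates_Comp_1[OF evaluates_pair this]
    have "evaluates mL [?e] (trms_encode {freeze c p})"
      using mL[of ?e] by (simp add: trms_encode_def freeze_code_trm_encode)
    note L = evaluates_Comp_1[OF evaluates_pair this]
    have "evaluates mQ [?e] (trm_encode (freeze c q))"
      using mQ[of ?e] by (simp add: freeze_code_trm_encode)
    note Q = evaluates_Comp_1[OF evaluates_pair this]
    have "evaluates mD [prod_encode (bta_encode C, trm_encode (freeze c q))]
        (of_bool ((p, q) \<in> (rstep R)\<^sup>*))"
      using mD[of "prod_encode (bta_encode C, trm_encode (freeze c q))"] accepts by simp
    with evaluates_Comp_2[OF evaluates_Comp_2[OF A L mC] Q evaluates_pair] show ?thesis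
      by (rule evaluates_Comp_1)
  qed
  show ?thesis
    unfolding decidable_def
  proof (intro exI ballI)
    fix x assume "x \<in> terms \<Sigma> \<times> terms \<Sigma>"
    then obtain p q where "x = (p, q)" "p \<in> terms \<Sigma>" "q \<in> terms \<Sigma>" by blast
    then show "evaluates ?M (case x of (p, q) \<Rightarrow> [trm_encode p, trm_encode q])
        (if case x of (p, q) \<Rightarrow> (p, q) \<in> (rstep R)\<^sup>* then 1 else 0)"
      using correct[of p q] by (simp add: of_bool_def)
  qed
qed

end
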